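(* For any $X\in\{F,G,H\}$, the Laurent polynomial \[\widetilde{X}(K;t)=X_{00}(K;t)-X_{01}(K;t)-X_{10}(K;t)+X_{11}(K;t)\] of a long virtual knot $K$ is invariant under crossing changes; that is, if long virtual knots $K$ and $K'$ are presented by diagrams related by a crossing change, then $\widetilde{X}(K;t)=\widetilde{X}(K';t)$.
   Context: A long virtual knot diagram is an immersed line in $\mathbb{R}^2$ that agrees with the $x$-axis outside some $2$-disk and has finitely many transversal double points, each being either a real crossing (with over/under information) or a virtual crossing (without it); it is oriented from $-\infty$ to $\infty$. A long virtual knot is an equivalence class of such diagrams under generalized Reidemeister moves (the classical moves I, II, III on real crossings, the three analogous moves on virtual crossings, and the mixed move passing a strand having only virtual crossings across a real crossing). A crossing change is a local move on a long virtual knot diagram that switches the over/under information at a real crossing. Let $D$ be a diagram of a long virtual knot $K$ with real crossings $c_1,\dots,c_n$, and let $\varepsilon_i\in\{1,-1\}$ be the sign of $c_i$. The crossing $c_i$ is of type $0$ if, travelling along $D$ from $-\infty$ to $\infty$, one passes $c_i$ first over and then under; otherwise it is of type $1$. For $a\in\{0,1\}$ put $I_a=\{i\mid c_i\text{ is of type }a\}$ and $\omega_a=\sum_{i\in I_a}\varepsilon_i$. A surface realization of $D$ is a closed, connected, oriented surface $\Sigma_g$ together with an oriented knot diagram on $\Sigma_g$ with a basepoint and with no virtual crossings, whose real crossings coincide with those of $D$ (same order of passage, over/under information and signs), and whose basepoint corresponds to $\pm\infty$ of $D$. Smoothing this diagram at $c_i$ (respecting orientation) gives two oriented loops on $\Sigma_g$: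 $\alpha_i$ is the one not containing the basepoint and $\beta_i$ is the one containing it; they are regarded as homology cycles on $\Sigma_g$. The intersection numbers $\gamma\cdot\gamma'\in\mathbb{Z}$ of such cycles are independent of the choice of surface realization. Put $W_a(K;t)=\sum_{i\in I_a}\varepsilon_i(t^{\alpha_i\cdot\beta_i}-1)$ and, for $a,b\in\{0,1\}$, \[F_{ab}(K;t)=\sum_{i\in I_a,\,j\in I_b}\varepsilon_i\varepsilon_j(t^{\alpha_i\cdot\alpha_j}-1),\] \[G_{ab}(K;t)=\sum_{i\in I_a,\,j\in I_b}\varepsilon_i\varepsilon_j(t^{\alpha_i\cdot\beta_j}-1)-\omega_bW_a(K;t),\] \[H_{ab}(K;t)=\sum_{i\in I_a,\,j\in I_b}\varepsilon_i\varepsilon_j(t^{\beta_i\cdot\beta_j}-1)-\omega_aW_b(K;t)-\omega_bW_a(K;t^{-1}).\] These Laurent polynomials in $\mathbb{Z}[t,t^{-1}]$ depend only on $K$, not on $D$. *)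

theory Defs
  imports "HOL-Analysis.Analysis" "HOL-Homology.Homology" "HOL-Library.Poly_Mapping"
begin

section \<open>Long virtual knot diagrams\<close>

text \<open>
  For a double point \<open>line D s = line D t\<close> with \<open>s < t\<close>, \<^term>\<open>Over_First\<close> says that the passage at
  time \<open>s\<close> is the over-passage (type 0), \<^term>\<open>Under_First\<close> that the one at time \<open>t\<close> is (type 1).
  Values of \<open>info\<close> away from the double points carry no meaning and are never inspected.
\<close>

datatype crossing_info = Over_First | Under_First | Virtual

record diagram =
  line :: "real \<Rightarrow> real^2"
  info :: "real \<times> real \<Rightarrow> crossing_info"

definition velocity :: "(real \<Rightarrow> 'a::real_normed_vector) \<Rightarrow> real \<Rightarrow> 'a" where
  "velocity f t = vector_derivative f (at t)"

definition immersed :: "(real \<Rightarrow> 'a::real_normed_vector) \<Rightarrow> bool" where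
  "immersed f \<longleftrightarrow> f C1_differentiable_on UNIV \<and> (\<forall>t. velocity f t \<noteq> 0)"

definition det2 :: "real^2 \<Rightarrow> real^2 \<Rightarrow> real" where
  "det2 u v = u$1 * v$2 - u$2 * v$1"

definition crossings :: "diagram \<Rightarrow> (real \<times> real) set" where
  "crossings D = {(s, t). s < t \<and> line D s = line D t}"

definition real_crossings :: "diagram \<Rightarrow> (real \<times> real) set" where
  "real_crossings D = {x \<in> crossings D. info D x \<noteq> Virtual}"

text \<open>
  The parametrization is normalized so that the line runs along the \<open>x\<close>-axis with unit speed, from
  \<open>-\<infinity>\<close> to \<open>\<infinity>\<close>, for large \<open>\<bar>t\<bar>\<close>; the compact rest of the line lies in some disk.
\<close>

definition is_diagram :: "diagram \<Rightarrow> bool" where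
  "is_diagram D \<longleftrightarrow>
     immersed (line D) \<and>
     (\<exists>r. \<forall>t. \<bar>t\<bar> \<ge> r \<longrightarrow> line D t = vector [t, 0]) \<and>
     finite (crossings D) \<and>
     (\<forall>(s, t) \<in> crossings D. det2 (velocity (line D) s) (velocity (line D) t) \<noteq> 0) \<and>
     (\<forall>s t u. s < t \<and> t < u \<longrightarrow> \<not> (line D s = line D t \<and> line D t = line D u))"

section \<open>Generalized Reidemeister moves and long virtual knots\<close>

text \<open>
  Planar isotopy and reparametrization: a compactly supported orientation-preserving
  \<open>C\<^sup>1\<close>-diffeomorphism of the plane is isotopic to the identity.
\<close>

definition plane_diffeo :: "(real^2 \<Rightarrow> real^2) \<Rightarrow> bool" where
  "plane_diffeo \<phi> \<longleftrightarrow>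
     bij \<phi> \<and>
     (\<exists>J :: real^2 \<Rightarrow> real^2^2. continuous_on UNIV J \<and>
        (\<forall>x. (\<phi> has_derivative (\<lambda>v. J x *v v)) (at x) \<and> det (J x) > 0)) \<and>
     (\<exists>r. \<forall>x. norm x \<ge> r \<longrightarrow> \<phi> x = x)"

definition line_diffeo :: "(real \<Rightarrow> real) \<Rightarrow> bool" where
  "line_diffeo h \<longleftrightarrow>
     bij h \<and> h C1_differentiable_on UNIV \<and> (\<forall>t. velocity h t > 0) \<and>
     (\<exists>r. \<forall>t. \<bar>t\<bar> \<ge> r \<longrightarrow> h t = t)"

definition isotopy_move :: "diagram \<Rightarrow> diagram \<Rightarrow> bool" where
  "isotopy_move D D' \<longleftrightarrow>
     (\<exists>\<phi> h. plane_diffeo \<phi> \<and> line_diffeo h \<and>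
        line D' = \<phi> \<circ> line D \<circ> h \<and>
        (\<forall>(s, t) \<in> crossings D'. info D' (s, t) = info D (h s, h t)))"

text \<open>
  Two diagrams that coincide outside a round disk, inside of which both consist of the proper arcs
  traced during the time intervals listed in \<open>Js\<close>, in this order. Up to isotopy every Reidemeister
  move takes place in a round disk, and the pictures of the moves are determined, up to isotopy of
  the disk, by which of the arcs cross each other and how often.
\<close>

definition coincide_outside ::
  "real^2 \<Rightarrow> real \<Rightarrow> (real \<times> real) list \<Rightarrow> diagram \<Rightarrow> diagram \<Rightarrow> bool" where
  "coincide_outside p r Js D D' \<longleftrightarrow>
     r > 0 \<and>
     (\<forall>(a, b) \<in> set Js. a < b) \<and>
     sorted_wrt (\<lambda>(a, b) (c, d). b < c) Js \<and>
     (\<forall>E \<in> {D, D'}. line E -` cball p r = (\<Union>(a, b) \<in> set Js. {a..b}) \<and>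
                    line E -` ball p r = (\<Union>(a, b) \<in> set Js. {a<..<b})) \<and>
     (\<forall>t. line D t \<notin> ball p r \<longrightarrow> line D' t = line D t) \<and>
     (\<forall>(s, t) \<in> crossings D. line D s \<notin> ball p r \<longrightarrow> info D' (s, t) = info D (s, t))"

definition crossings_in :: "real^2 \<Rightarrow> real \<Rightarrow> diagram \<Rightarrow> (real \<times> real) set" where
  "crossings_in p r D = {(s, t) \<in> crossings D. line D s \<in> cball p r}"

definition move_I :: "diagram \<Rightarrow> diagram \<Rightarrow> bool" where
  "move_I D D' \<longleftrightarrow>
     (\<exists>p r a b s t. coincide_outside p r [(a, b)] D D' \<and>
        {s, t} \<subseteq> {a<..<b} \<and>
        crossings_in p r D = {} \<and> crossings_in p r D' = {(s, t)})"

text \<open>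
  In the second move the same strand is over at both crossings, or both crossings are virtual.
\<close>

definition move_II :: "diagram \<Rightarrow> diagram \<Rightarrow> bool" where
  "move_II D D' \<longleftrightarrow>
     (\<exists>p r a1 b1 a2 b2 s t s' t'. coincide_outside p r [(a1, b1), (a2, b2)] D D' \<and>
        {s, s'} \<subseteq> {a1<..<b1} \<and> {t, t'} \<subseteq> {a2<..<b2} \<and> s \<noteq> s' \<and>
        crossings_in p r D = {} \<and> crossings_in p r D' = {(s, t), (s', t')} \<and>
        info D' (s, t) = info D' (s', t'))"

text \<open>
  Admissible labels for the crossings \<open>12\<close>, \<open>13\<close>, \<open>23\<close> of the three strands of the third move:
  either all are real and some strand lies over the other two, some strand under the other two
  (the two excluded patterns are the cyclic ones), or at least two are virtual, that is, some strand
  has only virtual crossings. One virtual and two real crossings are forbidden.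
\<close>

definition triangle_labels :: "crossing_info \<Rightarrow> crossing_info \<Rightarrow> crossing_info \<Rightarrow> bool" where
  "triangle_labels l12 l13 l23 \<longleftrightarrow>
     (Virtual \<notin> {l12, l13, l23} \<and> \<not> (l12 = l23 \<and> l13 \<noteq> l12)) \<or>
     (l12 = Virtual \<and> l13 = Virtual) \<or>
     (l12 = Virtual \<and> l23 = Virtual) \<or>
     (l13 = Virtual \<and> l23 = Virtual)"

text \<open>
  \<open>xij\<close> is the time at which strand \<open>i\<close> meets strand \<open>j\<close> in \<open>D\<close>, and \<open>yij\<close> the one in \<open>D'\<close>. Passing
  the triangle reverses the order of the two crossings on each strand.
\<close>

definition move_III :: "diagram \<Rightarrow> diagram \<Rightarrow> bool" where
  "move_III D D' \<longleftrightarrow>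
     (\<exists>p r a1 b1 a2 b2 a3 b3 x12 x13 x21 x23 x31 x32 y12 y13 y21 y23 y31 y32.
        coincide_outside p r [(a1, b1), (a2, b2), (a3, b3)] D D' \<and>
        {x12, x13, y12, y13} \<subseteq> {a1<..<b1} \<and>
        {x21, x23, y21, y23} \<subseteq> {a2<..<b2} \<and>
        {x31, x32, y31, y32} \<subseteq> {a3<..<b3} \<and>
        crossings_in p r D = {(x12, x21), (x13, x31), (x23, x32)} \<and>
        crossings_in p r D' = {(y12, y21), (y13, y31), (y23, y32)} \<and>
        (x12 < x13 \<longleftrightarrow> y13 < y12) \<and> (x21 < x23 \<longleftrightarrow> y23 < y21) \<and> (x31 < x32 \<longleftrightarrow> y32 < y31) \<and>
        info D (x12, x21) = info D' (y12, y21) \<and>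
        info D (x13, x31) = info D' (y13, y31) \<and>
        info D (x23, x32) = info D' (y23, y32) \<and>
        triangle_labels (info D (x12, x21)) (info D (x13, x31)) (info D (x23, x32)))"

definition generalized_move :: "diagram \<Rightarrow> diagram \<Rightarrow> bool" where
  "generalized_move D D' \<longleftrightarrow>
     is_diagram D \<and> is_diagram D' \<and>
     (isotopy_move D D' \<or> move_I D D' \<or> move_II D D' \<or> move_III D D')"

definition long_virtual_knot :: "diagram set \<Rightarrow> bool" where
  "long_virtual_knot K \<longleftrightarrow>
     (\<exists>D. is_diagram D \<and> K = {D'. is_diagram D' \<and> equivclp generalized_move D D'})"

fun switch :: "crossing_info \<Rightarrow> crossing_info" where
  "switch Over_First = Under_First"
| "switch Under_First = Over_First"
| "switch Virtual = Virtual"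

definition crossing_change :: "diagram \<Rightarrow> diagram \<Rightarrow> bool" where
  "crossing_change D D' \<longleftrightarrow>
     line D' = line D \<and>
     (\<exists>x \<in> real_crossings D. info D' x = switch (info D x) \<and>
        (\<forall>y \<in> crossings D - {x}. info D' y = info D y))"

section \<open>Signs and types of real crossings\<close>

definition isgn :: "real \<Rightarrow> int" where
  "isgn d = (if d > 0 then 1 else if d < 0 then - 1 else 0)"

text \<open>
  A crossing is positive iff (over direction, under direction) is a positive basis. Below, \<open>d\<close> is the
  determinant of (first direction, second direction).
\<close>

definition sign_from :: "crossing_info \<Rightarrow> real \<Rightarrow> int" where
  "sign_from l d = (if l = Over_First then isgn d else isgn (- d))"

definition crossing_sign :: "diagram \<Rightarrow> real \<times> real \<Rightarrow> int" where
  "crossing_sign D x =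
     sign_from (info D x) (det2 (velocity (line D) (fst x)) (velocity (line D) (snd x)))"

definition crossing_type :: "diagram \<Rightarrow> real \<times> real \<Rightarrow> nat" where
  "crossing_type D x = (if info D x = Over_First then 0 else 1)"

definition type_set :: "nat \<Rightarrow> diagram \<Rightarrow> (real \<times> real) set" where
  "type_set a D = {x \<in> real_crossings D. crossing_type D x = a}"

definition omega :: "nat \<Rightarrow> diagram \<Rightarrow> int" where
  "omega a D = (\<Sum>x \<in> type_set a D. crossing_sign D x)"

section \<open>Closed oriented surfaces and intersection numbers\<close>

text \<open>
  A closed connected oriented surface is realized, as is always possible, as a \<open>C\<^sup>1\<close>-submanifold of
  \<open>\<real>\<^sup>3\<close> (locally a regular level set of a function \<open>g\<close> with gradient \<open>h\<close>), oriented by a unit normal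
  field \<open>N\<close>: a basis \<open>(u, v)\<close> of the tangent plane at \<open>x\<close> is positive iff \<open>(N x, u, v)\<close> is positive.
\<close>

definition closed_oriented_surface :: "(real^3) set \<Rightarrow> (real^3 \<Rightarrow> real^3) \<Rightarrow> bool" where
  "closed_oriented_surface \<Sigma> N \<longleftrightarrow>
     compact \<Sigma> \<and> connected \<Sigma> \<and> \<Sigma> \<noteq> {} \<and>
     (\<forall>p \<in> \<Sigma>. \<exists>U (g :: real^3 \<Rightarrow> real) h. open U \<and> p \<in> U \<and>
        (\<forall>x \<in> U. (g has_derivative (\<lambda>v. h x \<bullet> v)) (at x) \<and> h x \<noteq> 0) \<and>
        continuous_on U h \<and>
        \<Sigma> \<inter> U = {x \<in> U. g x = 0} \<and>
        (\<forall>x \<in> \<Sigma> \<inter> U. N x = h x /\<^sub>R norm (h x)))"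

definition area_form :: "(real^3 \<Rightarrow> real^3) \<Rightarrow> real^3 \<Rightarrow> real^3 \<Rightarrow> real^3 \<Rightarrow> real" where
  "area_form N x u v = N x \<bullet> cross3 u v"

text \<open>The singular \<open>1\<close>-chain of a path parametrized by \<open>{0..1}\<close>.\<close>

definition path_chain :: "(real \<Rightarrow> 'a) \<Rightarrow> 'a chain" where
  "path_chain \<gamma> = frag_of (restrict (\<lambda>x. \<gamma> (x 1)) (standard_simplex 1))"

definition homologous_loops :: "'a::topological_space set \<Rightarrow> (real \<Rightarrow> 'a) \<Rightarrow> (real \<Rightarrow> 'a) \<Rightarrow> bool" where
  "homologous_loops \<Sigma> \<gamma> \<delta> \<longleftrightarrow>
     homologous_rel 1 (top_of_set \<Sigma>) {} (path_chain \<gamma>) (path_chain \<delta>)"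

definition smooth_loop :: "(real^3) set \<Rightarrow> (real \<Rightarrow> real^3) \<Rightarrow> bool" where
  "smooth_loop \<Sigma> p \<longleftrightarrow> p C1_differentiable_on UNIV \<and> range p \<subseteq> \<Sigma> \<and> (\<forall>t. p (t + 1) = p t)"

definition meeting_times :: "(real \<Rightarrow> 'a) \<Rightarrow> (real \<Rightarrow> 'a) \<Rightarrow> (real \<times> real) set" where
  "meeting_times p q = {(u, v). u \<in> {0..<1} \<and> v \<in> {0..<1} \<and> p u = q v}"

definition transverse_loops ::
  "(real^3 \<Rightarrow> real^3) \<Rightarrow> (real \<Rightarrow> real^3) \<Rightarrow> (real \<Rightarrow> real^3) \<Rightarrow> bool" where
  "transverse_loops N p q \<longleftrightarrow>
     finite (meeting_times p q) \<and>
     (\<forall>(u, v) \<in> meeting_times p q. area_form N (p u) (velocity p u) (velocity q v) \<noteq> 0)"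

definition signed_count ::
  "(real^3 \<Rightarrow> real^3) \<Rightarrow> (real \<Rightarrow> real^3) \<Rightarrow> (real \<Rightarrow> real^3) \<Rightarrow> int" where
  "signed_count N p q =
     (\<Sum>(u, v) \<in> meeting_times p q. isgn (area_form N (p u) (velocity p u) (velocity q v)))"

text \<open>
  The homological intersection number of the closed paths \<open>\<gamma>\<close>, \<open>\<delta>\<close>: the signed number of meeting
  points of transverse loops in their homology classes.
\<close>

definition intersection_number ::
  "(real^3) set \<Rightarrow> (real^3 \<Rightarrow> real^3) \<Rightarrow> (real \<Rightarrow> real^3) \<Rightarrow> (real \<Rightarrow> real^3) \<Rightarrow> int" where
  "intersection_number \<Sigma> N \<gamma> \<delta> =
     (THE n. \<exists>p q. smooth_loop \<Sigma> p \<and> smooth_loop \<Sigma> q \<and>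
        homologous_loops \<Sigma> \<gamma> p \<and> homologous_loops \<Sigma> \<delta> q \<and>
        transverse_loops N p q \<and> n = signed_count N p q)"

section \<open>Surface realizations\<close>

text \<open>
  A knot diagram without virtual crossings on an oriented surface: a \<open>1\<close>-periodic immersion \<open>c\<close> with
  basepoint \<open>c 0\<close>, and crossing information \<open>w\<close> with respect to the order of passage from the
  basepoint.
\<close>

definition surface_crossings :: "(real \<Rightarrow> real^3) \<Rightarrow> (real \<times> real) set" where
  "surface_crossings c = {(u, v). 0 \<le> u \<and> u < v \<and> v < 1 \<and> c u = c v}"

definition surface_diagram ::
  "(real^3) set \<Rightarrow> (real^3 \<Rightarrow> real^3) \<Rightarrow> (real \<Rightarrow> real^3) \<Rightarrow> (real \<times> real \<Rightarrow> crossing_info) \<Rightarrow> bool"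
  where
  "surface_diagram \<Sigma> N c w \<longleftrightarrow>
     smooth_loop \<Sigma> c \<and> immersed c \<and>
     finite (surface_crossings c) \<and>
     (\<forall>(u, v) \<in> surface_crossings c.
        u \<noteq> 0 \<and> w (u, v) \<noteq> Virtual \<and> area_form N (c u) (velocity c u) (velocity c v) \<noteq> 0) \<and>
     (\<forall>u v z. 0 \<le> u \<and> u < v \<and> v < z \<and> z < 1 \<longrightarrow> \<not> (c u = c v \<and> c v = c z))"

definition surface_crossing_sign ::
  "(real^3 \<Rightarrow> real^3) \<Rightarrow> (real \<Rightarrow> real^3) \<Rightarrow> (real \<times> real \<Rightarrow> crossing_info) \<Rightarrow> real \<times> real \<Rightarrow> int"
  where
  "surface_crossing_sign N c w x =
     sign_from (w x) (area_form N (c (fst x)) (velocity c (fst x)) (velocity c (snd x)))"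

text \<open>
  \<open>\<tau>\<close> matches the times at which \<open>D\<close> passes its real crossings with those of the surface diagram,
  preserving the order of passage.
\<close>

definition surface_realization ::
  "diagram \<Rightarrow> (real^3) set \<Rightarrow> (real^3 \<Rightarrow> real^3) \<Rightarrow> (real \<Rightarrow> real^3) \<Rightarrow>
   (real \<times> real \<Rightarrow> crossing_info) \<Rightarrow> (real \<Rightarrow> real) \<Rightarrow> bool" where
  "surface_realization D \<Sigma> N c w \<tau> \<longleftrightarrow>
     closed_oriented_surface \<Sigma> N \<and> surface_diagram \<Sigma> N c w \<and>
     strict_mono_on (\<Union>(s, t) \<in> real_crossings D. {s, t}) \<tau> \<and>
     surface_crossings c = (\<lambda>(s, t). (\<tau> s, \<tau> t)) ` real_crossings D \<and>
     (\<forall>(s, t) \<in> real_crossings D.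
        w (\<tau> s, \<tau> t) = info D (s, t) \<and>
        surface_crossing_sign N c w (\<tau> s, \<tau> t) = crossing_sign D (s, t))"

text \<open>
  The loops obtained by smoothing at the crossing \<open>(s, t)\<close>: \<open>\<alpha>\<close> runs from the first passage to the
  second one, \<open>\<beta>\<close> from the second passage through the basepoint (at time \<open>1\<close>) to the first one.
\<close>

datatype smoothing_loop = Alpha "real \<times> real" | Beta "real \<times> real"

fun loop_path :: "(real \<Rightarrow> real^3) \<Rightarrow> (real \<Rightarrow> real) \<Rightarrow> smoothing_loop \<Rightarrow> real \<Rightarrow> real^3" where
  "loop_path c \<tau> (Alpha (s, t)) = (\<lambda>x. c (\<tau> s + x * (\<tau> t - \<tau> s)))"
| "loop_path c \<tau> (Beta (s, t)) = (\<lambda>x. c (\<tau> t + x * (\<tau> s + 1 - \<tau> t)))"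

text \<open>The value is the same for all surface realizations of \<open>D\<close>.\<close>

definition loop_intersection :: "diagram \<Rightarrow> smoothing_loop \<Rightarrow> smoothing_loop \<Rightarrow> int" where
  "loop_intersection D \<gamma> \<delta> =
     (THE n. \<exists>\<Sigma> N c w \<tau>. surface_realization D \<Sigma> N c w \<tau> \<and>
        n = intersection_number \<Sigma> N (loop_path c \<tau> \<gamma>) (loop_path c \<tau> \<delta>))"

section \<open>The intersection polynomials\<close>

text \<open>\<open>\<int>[t, t\<^sup>-\<^sup>1]\<close> is the group ring of the additive group of integers.\<close>

type_synonym laurent_poly = "int \<Rightarrow>\<^sub>0 int"

definition t_pow :: "int \<Rightarrow> laurent_poly" where
  "t_pow n = Poly_Mapping.single n 1"

definition invert_t :: "laurent_poly \<Rightarrow> laurent_poly" where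
  "invert_t p = Poly_Mapping.map_key uminus p"

definition W_poly :: "nat \<Rightarrow> diagram \<Rightarrow> laurent_poly" where
  "W_poly a D =
     (\<Sum>i \<in> type_set a D.
        of_int (crossing_sign D i) * (t_pow (loop_intersection D (Alpha i) (Beta i)) - 1))"

definition F_poly :: "nat \<Rightarrow> nat \<Rightarrow> diagram \<Rightarrow> laurent_poly" where
  "F_poly a b D =
     (\<Sum>i \<in> type_set a D. \<Sum>j \<in> type_set b D.
        of_int (crossing_sign D i * crossing_sign D j) *
        (t_pow (loop_intersection D (Alpha i) (Alpha j)) - 1))"

definition G_poly :: "nat \<Rightarrow> nat \<Rightarrow> diagram \<Rightarrow> laurent_poly" where
  "G_poly a b D =
     (\<Sum>i \<in> type_set a D. \<Sum>j \<in> type_set b D.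
        of_int (crossing_sign D i * crossing_sign D j) *
        (t_pow (loop_intersection D (Alpha i) (Beta j)) - 1))
     - of_int (omega b D) * W_poly a D"

definition H_poly :: "nat \<Rightarrow> nat \<Rightarrow> diagram \<Rightarrow> laurent_poly" where
  "H_poly a b D =
     (\<Sum>i \<in> type_set a D. \<Sum>j \<in> type_set b D.
        of_int (crossing_sign D i * crossing_sign D j) *
        (t_pow (loop_intersection D (Beta i) (Beta j)) - 1))
     - of_int (omega a D) * W_poly b D
     - of_int (omega b D) * invert_t (W_poly a D)"

definition tilde :: "(nat \<Rightarrow> nat \<Rightarrow> diagram \<Rightarrow> laurent_poly) \<Rightarrow> diagram \<Rightarrow> laurent_poly" where
  "tilde X D = X 0 0 D - X 0 1 D - X 1 0 D + X 1 1 D"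

text \<open>
  \<open>p\<close> is the value at the knot \<open>K\<close> of an invariant \<open>f\<close> that is computed from an arbitrary diagram of
  the knot.
\<close>

definition has_knot_value :: "(diagram \<Rightarrow> laurent_poly) \<Rightarrow> diagram set \<Rightarrow> laurent_poly \<Rightarrow> bool" where
  "has_knot_value f K p \<longleftrightarrow> (\<forall>D \<in> K. f D = p)"

end

theory Submission
  imports Defs
begin

text \<open>
  The alternating sum \<open>X\<^sub>0\<^sub>0 - X\<^sub>0\<^sub>1 - X\<^sub>1\<^sub>0 + X\<^sub>1\<^sub>1\<close> only sees the shadow of a diagram: the
  immersed line together with the set of its real crossings, but not which strand is over at them.
  A crossing change preserves the shadow. Two observations explain why the rest does not matter.

  First, the exponents. Over/under information on a surface diagram does not influence the loops
  obtained by smoothing, and it can be rewritten at will: a surface realization of one diagram becomes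
  a surface realization of any other diagram with the same shadow as soon as the labels are replaced
  (lemma \<open>surface_realization_relabel\<close>). Hence the intersection numbers of the two diagrams are
  described by the same set of candidates, and so they agree (\<open>loop_intersection_shadow\<close>).

  Second, the coefficients. Switching a crossing reverses its sign \<open>\<epsilon>\<close> and exchanges the types \<open>0\<close>
  and \<open>1\<close>, so \<open>(-1)\<^sup>a \<epsilon>\<close>, with \<open>a\<close> the type, is unaffected; it is the orientation of the basis formed
  by the velocities of the first and of the second passage. The alternating sum over the types turns
  every product \<open>\<epsilon>\<^sub>i \<epsilon>\<^sub>j\<close> into a product of these unaffected signs (\<open>type_difference\<close>,
  \<open>double_type_difference\<close>). The correction terms of \<open>G\<close> and \<open>H\<close> are products of a contribution of \<open>a\<close>
  and a contribution of \<open>b\<close>, so their alternating sums factor as \<open>(\<omega>\<^sub>0 - \<omega>\<^sub>1) (W\<^sub>0 - W\<^sub>1)\<close>, up to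
  replacing \<open>t\<close> by \<open>t\<^sup>-\<^sup>1\<close> in the second factor, and both factors are again differences over the types.
\<close>

section \<open>Diagrams with a common shadow\<close>

definition same_shadow :: "diagram \<Rightarrow> diagram \<Rightarrow> bool" where
  "same_shadow D D' \<longleftrightarrow> line D' = line D \<and> real_crossings D' = real_crossings D"

lemma same_shadow_sym: "same_shadow D D' \<Longrightarrow> same_shadow D' D"
  by (simp add: same_shadow_def)

lemma switch_eq_Virtual_iff [simp]: "switch l = Virtual \<longleftrightarrow> l = Virtual"
  by (cases l) auto

lemma crossing_change_same_shadow:
  assumes "crossing_change D D'"
  shows "same_shadow D D'"
proof -
  obtain x where line: "line D' = line D"
    and x: "info D' x = switch (info D x)"
    and other: "\<forall>y \<in> crossings D - {x}. info D' y = info D y"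
    using assms by (auto simp: crossing_change_def)
  have "crossings D' = crossings D"
    using line by (simp add: crossings_def)
  moreover have "info D' y = Virtual \<longleftrightarrow> info D y = Virtual" if "y \<in> crossings D" for y
    using x other that by (cases "y = x") auto
  ultimately show ?thesis
    using line by (auto simp: same_shadow_def real_crossings_def)
qed

section \<open>Intersection numbers of the smoothing loops\<close>

lemma isgn_minus [simp]: "isgn (- d) = - isgn d"
  by (simp add: isgn_def)

text \<open>
  A label only decides whether the orientation sign of the two passages is kept or reversed. This is
  what allows the labels of a surface realization to be changed without spoiling the match of signs.
\<close>

lemma sign_from_eq_iff: "sign_from l a = sign_from l d \<longleftrightarrow> isgn a = isgn d"
  by (simp add: sign_from_def)

text \<open>
  The surface, the curve and the matching \<open>\<tau>\<close> stay the same: the conditions on them only involve the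
  order of passage and, by \<open>sign_from_eq_iff\<close>, the orientations at the crossings. The new labels are
  read off from the other diagram, which is possible because \<open>\<tau>\<close> identifies the real crossings with
  those of the curve bijectively.
\<close>

lemma surface_realization_relabel:
  assumes shadow: "same_shadow D D'"
    and real: "surface_realization D \<Sigma> N c w \<tau>"
  shows "\<exists>w'. surface_realization D' \<Sigma> N c w' \<tau>"
proof -
  define R where "R = real_crossings D"
  define m where "m = (\<lambda>(s, t). (\<tau> s, \<tau> t))"
  define w' where "w' = (\<lambda>z. info D' (inv_into R m z))"
  have R': "real_crossings D' = R" and line: "line D' = line D"
    using shadow by (auto simp: same_shadow_def R_def)
  have mono: "strict_mono_on (\<Union>(s, t) \<in> R. {s, t}) \<tau>"
    and img: "surface_crossings c = m ` R"
    and surf: "closed_oriented_surface \<Sigma> N" "surface_diagram \<Sigma> N c w"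
    and match: "\<And>s t. (s, t) \<in> R \<Longrightarrow> w (\<tau> s, \<tau> t) = info D (s, t) \<and>
        surface_crossing_sign N c w (\<tau> s, \<tau> t) = crossing_sign D (s, t)"
    using real by (auto simp: surface_realization_def R_def m_def)
  have "inj_on \<tau> (\<Union>(s, t) \<in> R. {s, t})"
    using mono by (rule strict_mono_on_imp_inj_on)
  then have "inj_on m R"
    unfolding m_def by (intro inj_onI) (auto dest: inj_onD)
  then have w': "w' (\<tau> s, \<tau> t) = info D' (s, t)" if "(s, t) \<in> R" for s t
    using that inv_into_f_f[of m R "(s, t)"] by (simp add: w'_def m_def)
  have nonvirtual: "w' z \<noteq> Virtual" if z: "z \<in> surface_crossings c" for z
  proof -
    obtain s t where st: "(s, t) \<in> R" "z = (\<tau> s, \<tau> t)"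
      using z img by (auto simp: m_def)
    then have "info D' (s, t) \<noteq> Virtual"
      using R' by (auto simp: real_crossings_def)
    then show ?thesis
      using st w' by simp
  qed
  have "surface_diagram \<Sigma> N c w'"
    using surf(2) nonvirtual unfolding surface_diagram_def by blast
  moreover have "surface_crossing_sign N c w' (\<tau> s, \<tau> t) = crossing_sign D' (s, t)"
    if "(s, t) \<in> R" for s t
    using match[OF that] w'[OF that] line
    by (auto simp: surface_crossing_sign_def crossing_sign_def sign_from_eq_iff)
  ultimately have "surface_realization D' \<Sigma> N c w' \<tau>"
    using surf(1) mono img w' by (auto simp: surface_realization_def R' m_def)
  then show ?thesis by blast
qed

lemma loop_intersection_shadow:
  assumes "same_shadow D D'"
  shows "loop_intersection D' \<gamma> \<delta> = loop_intersection D \<gamma> \<delta>"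
proof -
  \<comment> \<open>Both numbers are definite descriptions, so it suffices that their predicates coincide.\<close>
  define candidate where "candidate = (\<lambda>E n. \<exists>\<Sigma> N c w \<tau>. surface_realization E \<Sigma> N c w \<tau> \<and>
      n = intersection_number \<Sigma> N (loop_path c \<tau> \<gamma>) (loop_path c \<tau> \<delta>))"
  have transfer: "candidate E' n" if shadow: "same_shadow E E'" and cand: "candidate E n" for E E' n
  proof -
    obtain \<Sigma> N c w \<tau> where real: "surface_realization E \<Sigma> N c w \<tau>"
      and n: "n = intersection_number \<Sigma> N (loop_path c \<tau> \<gamma>) (loop_path c \<tau> \<delta>)"
      using cand unfolding candidate_def by blast
    obtain w' where "surface_realization E' \<Sigma> N c w' \<tau>"
      using surface_realization_relabel[OF shadow real] ..
    with n show ?thesis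
      unfolding candidate_def by blast
  qed
  have "candidate D' = candidate D"
    using transfer assms same_shadow_sym by blast
  then show ?thesis
    by (simp add: loop_intersection_def candidate_def)
qed

section \<open>Alternating sums over the crossing types\<close>

definition passage_orientation :: "diagram \<Rightarrow> real \<times> real \<Rightarrow> int" where
  "passage_orientation D x =
     isgn (det2 (velocity (line D) (fst x)) (velocity (line D) (snd x)))"

text \<open>
  The type records exactly whether the crossing sign, which lists the over-passage first, agrees with
  the orientation, which lists the earlier passage first.
\<close>

lemma crossing_sign_type_0: "x \<in> type_set 0 D \<Longrightarrow> crossing_sign D x = passage_orientation D x"
  by (auto simp: type_set_def crossing_type_def crossing_sign_def sign_from_def
      passage_orientation_def split: if_splits)

lemma crossing_sign_type_1: "x \<in> type_set 1 D \<Longrightarrow> crossing_sign D x = - passage_orientation D x"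
  by (auto simp: type_set_def crossing_type_def crossing_sign_def sign_from_def
      passage_orientation_def split: if_splits)

lemma type_difference:
  fixes f :: "real \<times> real \<Rightarrow> 'a::comm_ring_1"
  assumes "finite (real_crossings D)"
  shows "(\<Sum>i \<in> type_set 0 D. of_int (crossing_sign D i) * f i)
       - (\<Sum>i \<in> type_set 1 D. of_int (crossing_sign D i) * f i)
       = (\<Sum>i \<in> real_crossings D. of_int (passage_orientation D i) * f i)"
proof -
  have split: "real_crossings D = type_set 0 D \<union> type_set 1 D" "type_set 0 D \<inter> type_set 1 D = {}"
    by (auto simp: type_set_def crossing_type_def)
  then have "finite (type_set 0 D)" "finite (type_set 1 D)"
    using assms by simp_all
  then have "(\<Sum>i \<in> real_crossings D. of_int (passage_orientation D i) * f i)
      = (\<Sum>i \<in> type_set 0 D. of_int (passage_orientation D i) * f i)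
      + (\<Sum>i \<in> type_set 1 D. of_int (passage_orientation D i) * f i)"
    unfolding split(1) using split(2) by (intro sum.union_disjoint)
  then show ?thesis
    by (simp add: crossing_sign_type_0 crossing_sign_type_1[simplified] sum_negf)
qed

text \<open>
  Each of the two summations is an alternating sum over the types, so the preceding identity applies
  to the inner one, with the outer crossing held fixed, and then to the outer one.
\<close>

lemma double_type_difference:
  fixes f :: "real \<times> real \<Rightarrow> real \<times> real \<Rightarrow> 'a::comm_ring_1"
  assumes "finite (real_crossings D)"
  defines "S \<equiv> \<lambda>a b. \<Sum>i \<in> type_set a D. \<Sum>j \<in> type_set b D.
      of_int (crossing_sign D i * crossing_sign D j) * f i j"
  shows "S 0 0 - S 0 1 - S 1 0 + S 1 1 = (\<Sum>i \<in> real_crossings D. \<Sum>j \<in> real_crossings D.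
      of_int (passage_orientation D i * passage_orientation D j) * f i j)"
proof -
  define r where "r = (\<lambda>i. \<Sum>j \<in> real_crossings D. of_int (passage_orientation D j) * f i j)"
  have inner: "S a 0 - S a 1 = (\<Sum>i \<in> type_set a D. of_int (crossing_sign D i) * r i)" for a
  proof -
    have "S a b = (\<Sum>i \<in> type_set a D. of_int (crossing_sign D i) *
        (\<Sum>j \<in> type_set b D. of_int (crossing_sign D j) * f i j))" for b
      by (simp add: S_def sum_distrib_left mult.assoc)
    then show ?thesis
      unfolding r_def type_difference[OF assms(1), symmetric]
      by (simp only: right_diff_distrib sum_subtractf)
  qed
  have "S 0 0 - S 0 1 - S 1 0 + S 1 1 = (S 0 0 - S 0 1) - (S 1 0 - S 1 1)"
    by simp
  also have "\<dots> = (\<Sum>i \<in> real_crossings D. of_int (passage_orientation D i) * r i)"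
    unfolding inner by (rule type_difference[OF assms(1)])
  also have "\<dots> = (\<Sum>i \<in> real_crossings D. \<Sum>j \<in> real_crossings D.
      of_int (passage_orientation D i * passage_orientation D j) * f i j)"
    by (simp add: r_def sum_distrib_left mult.assoc)
  finally show ?thesis .
qed

section \<open>Formulas in terms of the shadow\<close>

definition shadow_W :: "diagram \<Rightarrow> laurent_poly" where
  "shadow_W D = (\<Sum>i \<in> real_crossings D. of_int (passage_orientation D i) *
     (t_pow (loop_intersection D (Alpha i) (Beta i)) - 1))"

definition shadow_omega :: "diagram \<Rightarrow> int" where
  "shadow_omega D = (\<Sum>i \<in> real_crossings D. passage_orientation D i)"

definition shadow_sum ::
  "(real \<times> real \<Rightarrow> smoothing_loop) \<Rightarrow> (real \<times> real \<Rightarrow> smoothing_loop) \<Rightarrow> diagram \<Rightarrow> laurent_poly"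
  where
  "shadow_sum \<gamma> \<delta> D = (\<Sum>i \<in> real_crossings D. \<Sum>j \<in> real_crossings D.
     of_int (passage_orientation D i * passage_orientation D j) *
     (t_pow (loop_intersection D (\<gamma> i) (\<delta> j)) - 1))"

lemma W_difference:
  "finite (real_crossings D) \<Longrightarrow> W_poly 0 D - W_poly 1 D = shadow_W D"
  unfolding W_poly_def shadow_W_def by (rule type_difference)

lemma omega_difference:
  "finite (real_crossings D) \<Longrightarrow> omega 0 D - omega 1 D = shadow_omega D"
  using type_difference[of D "\<lambda>_. 1 :: int"] by (simp add: omega_def shadow_omega_def)

lemma invert_t_diff: "invert_t (p - q) = invert_t p - invert_t q"
proof -
  have "inj (uminus :: int \<Rightarrow> int)"
    by (simp add: inj_def)
  then show ?thesis
    by (intro poly_mapping_eqI) (simp add: invert_t_def map_key.rep_eq lookup_minus)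
qed

lemma tilde_F:
  "finite (real_crossings D) \<Longrightarrow> tilde F_poly D = shadow_sum Alpha Alpha D"
  unfolding tilde_def F_poly_def shadow_sum_def by (rule double_type_difference)

lemma tilde_G:
  assumes "finite (real_crossings D)"
  shows "tilde G_poly D = shadow_sum Alpha Beta D - of_int (shadow_omega D) * shadow_W D"
  unfolding shadow_sum_def double_type_difference[OF assms, symmetric]
    W_difference[OF assms, symmetric] omega_difference[OF assms, symmetric]
  by (simp add: tilde_def G_poly_def algebra_simps)

lemma tilde_H:
  assumes "finite (real_crossings D)"
  shows "tilde H_poly D = shadow_sum Beta Beta D - of_int (shadow_omega D) * shadow_W D
    - of_int (shadow_omega D) * invert_t (shadow_W D)"
  unfolding shadow_sum_def double_type_difference[OF assms, symmetric]
    W_difference[OF assms, symmetric] omega_difference[OF assms, symmetric] invert_t_diff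
  by (simp add: tilde_def H_poly_def algebra_simps)

lemma tilde_shadow_invariant:
  assumes X: "X \<in> {F_poly, G_poly, H_poly}"
    and fin: "finite (real_crossings D)" and shadow: "same_shadow D D'"
  shows "tilde X D = tilde X D'"
proof -
  have R: "real_crossings D' = real_crossings D"
    and orient: "passage_orientation D' = passage_orientation D"
    using shadow by (auto simp: same_shadow_def passage_orientation_def)
  have "shadow_W D' = shadow_W D" "shadow_omega D' = shadow_omega D"
    "shadow_sum \<gamma> \<delta> D' = shadow_sum \<gamma> \<delta> D" for \<gamma> \<delta>
    by (simp_all add: shadow_W_def shadow_omega_def shadow_sum_def R orient
        loop_intersection_shadow[OF shadow])
  moreover have "finite (real_crossings D')"
    using fin R by simp
  ultimately show ?thesis
    using X fin by (auto simp: tilde_F tilde_G tilde_H)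
qed

section \<open>Invariance under crossing changes\<close>

theorem theorem7p2:
  fixes K K' :: "diagram set" and D D' :: diagram
    and X :: "nat \<Rightarrow> nat \<Rightarrow> diagram \<Rightarrow> laurent_poly"
  assumes "X \<in> {F_poly, G_poly, H_poly}"
    and "long_virtual_knot K" and "long_virtual_knot K'"
    and "D \<in> K" and "D' \<in> K'" and "crossing_change D D'"
  shows "tilde X D = tilde X D' \<and>
    (\<forall>p p'. has_knot_value (tilde X) K p \<and> has_knot_value (tilde X) K' p' \<longrightarrow> p = p')"
proof -
  have "is_diagram D"
    using assms(2,4) by (auto simp: long_virtual_knot_def)
  then have "finite (real_crossings D)"
    by (auto simp: is_diagram_def real_crossings_def)
  then have "tilde X D = tilde X D'"
    using assms(1,6) by (intro tilde_shadow_invariant crossing_change_same_shadow)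
  then show ?thesis
    using assms(4,5) by (auto simp: has_knot_value_def)
qed

end
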